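(* Let $\Gamma\subset\mathbb{R}^2$ be a $C^2$ Jordan curve and define $$u(x)=-\int_\Gamma E(x-y)\nu(y)\kappa(y)\,ds(y),\qquad x\in\mathbb{R}^2\setminus\Gamma .$$ Then, for any $z\in\Gamma$, the limits of $u$ from the interior and from the exterior along the normal direction exist and coincide. Specifically, $$\lim_{\ell\to0}u(z+\ell\nu(z))=-\frac1\pi\kappa(z)\nu(z)-\int_\Gamma E(z-y)\nu(y)\kappa(y)\,ds(y).$$
   Context: $E(x)=\dfrac{x\otimes x}{2\pi|x|^3}$ for $x\in\mathbb{R}^2\setminus\{0\}$, where $a\otimes b=(a_ib_j)_{i,j=1,2}$. $\nu$ is the unit normal to $\Gamma$ pointing outward from the bounded domain enclosed by $\Gamma$, $\tau$ is the counter-clockwise unit tangent, $s$ is arclength, and the curvature $\kappa$ is defined by $\kappa\nu=-\partial_s\tau$ (positive for circles). The limit $\ell\to0$ is two-sided ($\ell$ may be positive or negative). The integral on the right-hand side is an ordinary (Lebesgue) integral. *)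

theory Defs
  imports "HOL-Analysis.Analysis"
begin

definition outer :: "real^2 \<Rightarrow> real^2 \<Rightarrow> real^2^2"  (infixl "\<otimes>\<^sub>v" 75) where
  "a \<otimes>\<^sub>v b = (\<chi> i j. a $ i * b $ j)"

text \<open>Only the values for \<^term>\<open>x \<noteq> 0\<close> matter: in the integrals over the curve
  below, the argument vanishes on a null set of parameters at most.\<close>

definition E :: "real^2 \<Rightarrow> real^2^2" where
  "E x = (1 / (2 * pi * norm x ^ 3)) *\<^sub>R (x \<otimes>\<^sub>v x)"

abbreviation velocity :: "(real \<Rightarrow> real^2) \<Rightarrow> real \<Rightarrow> real^2" where
  "velocity \<gamma> t \<equiv> vector_derivative \<gamma> (at t)"

text \<open>A \<open>C\<^sup>2\<close> Jordan curve is the image \<^term>\<open>path_image \<gamma>\<close> of a regular parametrization \<open>\<gamma>\<close>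
  as follows, of either orientation and of arbitrary speed. Periodicity makes the curve closed
  and makes it \<open>C\<^sup>2\<close> across the point where it closes up as well.\<close>

definition C2_Jordan_param :: "(real \<Rightarrow> real^2) \<Rightarrow> bool" where
  "C2_Jordan_param \<gamma> \<longleftrightarrow>
     simple_path \<gamma> \<and> (\<forall>t. \<gamma> (t + 1) = \<gamma> t) \<and>
     \<gamma> C1_differentiable_on UNIV \<and> velocity \<gamma> C1_differentiable_on UNIV \<and>
     (\<forall>t. velocity \<gamma> t \<noteq> 0)"

definition rot90 :: "real^2 \<Rightarrow> real^2" where
  "rot90 v = vector [- (v $ 2), v $ 1]"

text \<open>\<open>\<gamma>\<close> runs counter-clockwise if the bounded domain enclosed by the curve lies on its left.\<close>

definition counterclockwise :: "(real \<Rightarrow> real^2) \<Rightarrow> bool" where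
  "counterclockwise \<gamma> \<longleftrightarrow>
     (\<forall>t. \<forall>\<^sub>F h in at_right 0. \<gamma> t + h *\<^sub>R rot90 (velocity \<gamma> t) \<in> inside (path_image \<gamma>))"

definition orientation :: "(real \<Rightarrow> real^2) \<Rightarrow> real" where
  "orientation \<gamma> = (if counterclockwise \<gamma> then 1 else - 1)"

text \<open>The counter-clockwise unit tangent, the outward unit normal, the derivative with respect to
  the arclength measured counter-clockwise, and the curvature, at the point \<^term>\<open>\<gamma> t\<close>.
  A Jordan curve that is not counter-clockwise is clockwise; hence the tangent is always
  counter-clockwise, the domain is on its left, and the normal on its right points outward.\<close>

definition tangent :: "(real \<Rightarrow> real^2) \<Rightarrow> real \<Rightarrow> real^2" where
  "tangent \<gamma> t = (orientation \<gamma> / norm (velocity \<gamma> t)) *\<^sub>R velocity \<gamma> t"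

definition normal :: "(real \<Rightarrow> real^2) \<Rightarrow> real \<Rightarrow> real^2" where
  "normal \<gamma> t = - rot90 (tangent \<gamma> t)"

definition arclength_deriv :: "(real \<Rightarrow> real^2) \<Rightarrow> (real \<Rightarrow> real^2) \<Rightarrow> real \<Rightarrow> real^2" where
  "arclength_deriv \<gamma> f t = (orientation \<gamma> / norm (velocity \<gamma> t)) *\<^sub>R vector_derivative f (at t)"

definition curvature :: "(real \<Rightarrow> real^2) \<Rightarrow> real \<Rightarrow> real" where
  "curvature \<gamma> t = (THE k. k *\<^sub>R normal \<gamma> t = - arclength_deriv \<gamma> (tangent \<gamma>) t)"

text \<open>Integration over the curve with respect to arclength. The integrand is given as a function
  of the parameter.\<close>

definition arc_integrable :: "(real \<Rightarrow> real^2) \<Rightarrow> (real \<Rightarrow> real^2) \<Rightarrow> bool" where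
  "arc_integrable \<gamma> f \<longleftrightarrow> set_integrable lborel {0..1} (\<lambda>t. norm (velocity \<gamma> t) *\<^sub>R f t)"

definition arc_integral :: "(real \<Rightarrow> real^2) \<Rightarrow> (real \<Rightarrow> real^2) \<Rightarrow> real^2" where
  "arc_integral \<gamma> f = (LINT t:{0..1}|lborel. norm (velocity \<gamma> t) *\<^sub>R f t)"

definition integrand :: "(real \<Rightarrow> real^2) \<Rightarrow> real^2 \<Rightarrow> real \<Rightarrow> real^2" where
  "integrand \<gamma> x t = curvature \<gamma> t *\<^sub>R (E (x - \<gamma> t) *v normal \<gamma> t)"

definition u :: "(real \<Rightarrow> real^2) \<Rightarrow> real^2 \<Rightarrow> real^2" where
  "u \<gamma> x = - arc_integral \<gamma> (integrand \<gamma> x)"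

end

theory Submission
  imports Defs "HOL-Probability.Sinc_Integral" "HOL-Library.Periodic_Fun" "HOL-Real_Asymp.Real_Asymp"
begin

text \<open>Let \<open>T\<close> be the unit tangent in the direction of the parametrization. Since
  \<open>\<kappa> \<nu> ds = - T' dt\<close>, one has \<open>u x = \<integral> E (x - \<gamma> s) T' s ds\<close>. Put \<open>z = \<gamma> t\<close>, \<open>x = z + l \<nu>\<close>,
  \<open>d s = z - \<gamma> (t + s)\<close>, \<open>g s = T' (t + s)\<close> and \<open>R = |l \<nu> + d s|\<close>. The kernel is, up to the factor \<open>1/(2\<pi>)\<close>,
  the sum of \<open>l (\<nu> \<bullet> g) (l \<nu> + d) / R\<^sup>3\<close> and \<open>(d \<bullet> g) (l \<nu> + d) / R\<^sup>3\<close>. As \<open>T'\<close> is orthogonal to \<open>T\<close>,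
  \<open>d \<bullet> g = O(s\<^sup>2)\<close>, whereas \<open>R\<close> is bounded below by a multiple of \<open>|s|\<close> and of \<open>|l|\<close>. So the second
  summand is bounded and converges to the integrand at \<open>z\<close>. After the substitution \<open>s = l \<sigma>\<close>
  the first one is dominated by a multiple of \<open>1 / (1 + \<sigma>\<^sup>2)\<close>, and its integral tends to an explicit
  one, which yields the extra term.\<close>

section \<open>The kernel in scalar form and integrals of periodic functions\<close>

lemma E_mult: "E x *v v = ((x \<bullet> v) / (2 * pi * norm x ^ 3)) *\<^sub>R x"
  by (simp add: E_def outer_def vec_eq_iff matrix_vector_mult_def inner_vec_def sum_2 add_divide_distrib algebra_simps)

text \<open>Subtracting the integer part of \<open>a\<close> leaves the interval from
  \<open>frac a\<close> to \<open>frac a + 1\<close>. It is cut at 1 and the right piece is moved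
  back by one period. The bound \<open>B\<close> supplies the integrability that the cutting
  needs.\<close>

lemma periodic_integral_shift:
  fixes f :: "real \<Rightarrow> 'a :: {banach, second_countable_topology}"
  assumes per: "\<And>s. f (s + 1) = f s" and meas [measurable]: "f \<in> borel_measurable borel"
    and bound: "\<And>s. norm (f s) \<le> B"
  shows "(LINT s:{a..a + 1}|lborel. f s) = (LINT s:{0..1}|lborel. f s)"
proof -
  interpret periodic_fun_simple' f by standard (rule per)
  have integ: "set_integrable lborel {p..q} f" for p q
    unfolding set_integrable_def
    by (rule integrableI_bounded_set_indicator[where B = B]) (auto simp: bound emeasure_lborel_Icc_eq)
  have shift: "(LINT s:{p + of_int k..q + of_int k}|lborel. f s) = (LINT s:{p..q}|lborel. f s)" for p q k
    unfolding set_lebesgue_integral_def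
    by (subst lborel_integral_real_affine[where c = 1 and t = "of_int k"])
       (auto simp: add.commute[of "of_int k"] plus_of_int indicator_def intro!: Bochner_Integration.integral_cong)
  have split: "(LINT s:{p..r}|lborel. f s) = (LINT s:{p..q}|lborel. f s) + (LINT s:{q..r}|lborel. f s)"
    if "p \<le> q" "q \<le> r" for p q r
  proof -
    have "AE x in lborel. x \<noteq> q" by (rule AE_lborel_singleton)
    then have "AE x in lborel. \<not> (x \<in> {p..q} \<and> x \<in> {q..r})" by eventually_elim auto
    moreover have "{p..r} = {p..q} \<union> {q..r}" using that by auto
    ultimately show ?thesis by (simp add: set_integral_Un_AE integ)
  qed
  have "(LINT s:{a..a + 1}|lborel. f s) = (LINT s:{frac a..frac a + 1}|lborel. f s)"
    using shift[of "frac a" "\<lfloor>a\<rfloor>" "frac a + 1"] by (simp add: frac_def)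
  also have "\<dots> = (LINT s:{frac a..1}|lborel. f s) + (LINT s:{1..frac a + 1}|lborel. f s)"
    by (rule split) (auto simp: frac_lt_1 less_imp_le)
  also have "(LINT s:{1..frac a + 1}|lborel. f s) = (LINT s:{0..frac a}|lborel. f s)"
    using shift[of 0 1 "frac a"] by simp
  also have "(LINT s:{frac a..1}|lborel. f s) + (LINT s:{0..frac a}|lborel. f s) = (LINT s:{0..1}|lborel. f s)"
    by (subst split[of 0 "frac a" 1]) (auto simp: frac_lt_1 less_imp_le)
  finally show ?thesis .
qed

section \<open>Distance between the curve and points on its normal\<close>

text \<open>Near 0, \<open>d s\<close> is close to \<open>- s *\<^sub>R w\<close>; since
  \<open>w\<close> is orthogonal to \<open>n\<close>, the component of
  \<open>l *\<^sub>R n + d s\<close> along \<open>w\<close> is comparable to |s| whatever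
  \<open>l\<close> is. Away from 0, compactness keeps \<open>d s\<close> away from zero, and a small
  \<open>l\<close> cannot cancel it. The bound by |l| then follows from the bound by |s|, because
  \<open>norm (d s)\<close> is at most a multiple of |s|.\<close>

lemma norm_normal_offset_ge:
  fixes d :: "real \<Rightarrow> 'a :: real_inner"
  assumes deriv: "(d has_vector_derivative - w) (at 0)" and d0: "d 0 = 0" and cont: "continuous_on UNIV d"
    and inj: "\<And>s. s \<noteq> 0 \<Longrightarrow> \<bar>s\<bar> \<le> 1/2 \<Longrightarrow> d s \<noteq> 0"
    and w: "w \<noteq> 0" and n: "norm n = 1" "w \<bullet> n = 0"
  obtains c l0 where "c > 0" "l0 > 0"
    "\<And>s l. \<bar>s\<bar> \<le> 1/2 \<Longrightarrow> \<bar>l\<bar> < l0 \<Longrightarrow> c * \<bar>s\<bar> \<le> norm (l *\<^sub>R n + d s)"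
    "\<And>s l. \<bar>s\<bar> \<le> 1/2 \<Longrightarrow> \<bar>l\<bar> < l0 \<Longrightarrow> c * \<bar>l\<bar> \<le> norm (l *\<^sub>R n + d s)"
proof -
  have "norm w / 2 > 0" using w by simp
  moreover have "\<forall>e>0. \<exists>\<delta>>0. \<forall>s. \<bar>s\<bar> < \<delta> \<longrightarrow> norm (d s + s *\<^sub>R w) \<le> e * \<bar>s\<bar>"
    using deriv unfolding has_vector_derivative_def has_derivative_at_alt by (simp add: d0)
  ultimately obtain \<delta> where \<delta>: "\<delta> > 0"
    and lin: "\<And>s. \<bar>s\<bar> < \<delta> \<Longrightarrow> norm (d s + s *\<^sub>R w) \<le> norm w / 2 * \<bar>s\<bar>"
    by meson
  \<comment> \<open>\<open>S\<close> collects the parameters that the linearisation at 0 does not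
    reach.\<close>
  define S where "S = {-1/2..1/2} - ball (0::real) \<delta>"
  have S: "compact S" unfolding S_def by (intro compact_diff) auto
  have far: "s \<in> S" if "\<bar>s\<bar> \<le> 1/2" "\<bar>s\<bar> \<ge> \<delta>" for s
    using that by (auto simp: S_def abs_le_iff)
  have contS: "continuous_on S (\<lambda>s. norm (d s))"
    by (intro continuous_intros continuous_on_subset[OF cont]) auto
  obtain m where m: "m > 0" "\<And>s. s \<in> S \<Longrightarrow> m \<le> norm (d s)"
  proof (cases "S = {}")
    \<comment> \<open>For large \<delta> there is no minimum to take, and any positive
      \<open>m\<close> serves.\<close>
    case True then show ?thesis using that[of 1] by simp
  next
    case False
    then obtain s0 where s0: "s0 \<in> S" "\<And>s. s \<in> S \<Longrightarrow> norm (d s0) \<le> norm (d s)"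
      using continuous_attains_inf[OF S _ contS] by auto
    have "d s0 \<noteq> 0" using s0(1) \<delta> by (intro inj) (auto simp: S_def)
    with s0 show ?thesis by (intro that[of "norm (d s0)"]) auto
  qed
  obtain M where M: "M > 0" "\<And>s. s \<in> S \<Longrightarrow> norm (d s) \<le> M"
    using compact_imp_bounded[OF compact_continuous_image[OF contS S]]
    unfolding bounded_pos by auto
  \<comment> \<open>The first entry comes from the linearisation, whose error is at most half of
    \<open>norm w * \<bar>s\<bar>\<close>; the second from
    \<open>M = M / \<delta> * \<delta>\<close> with |s| at least \<delta>.\<close>
  define L where "L = max (3/2 * norm w) (M / \<delta>)"
  have L: "norm (d s) \<le> L * \<bar>s\<bar>" if "\<bar>s\<bar> \<le> 1/2" for s
  proof (cases "\<bar>s\<bar> < \<delta>")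
    case True
    have "norm (d s) \<le> norm (d s + s *\<^sub>R w) + norm (s *\<^sub>R w)"
      by (metis add_diff_cancel_right' norm_triangle_ineq4)
    also have "\<dots> \<le> 3/2 * norm w * \<bar>s\<bar>" using lin[OF True] by (simp add: mult.commute)
    also have "\<dots> \<le> L * \<bar>s\<bar>" unfolding L_def by (intro mult_right_mono) auto
    finally show ?thesis .
  next
    case False
    have "norm (d s) \<le> M / \<delta> * \<delta>" using M(2)[OF far[OF that]] False \<delta> by simp
    also have "\<dots> \<le> L * \<bar>s\<bar>"
      unfolding L_def using False M(1) \<delta> by (intro mult_mono) (auto simp: le_max_iff_disj)
    finally show ?thesis .
  qed
  have Lpos: "L > 0" using M(1) \<delta> by (simp add: L_def less_max_iff_disj)
  define c where "c = min (norm w / 2) m"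
  have c: "c > 0" using m w by (simp add: c_def)
  have tangential: "c * \<bar>s\<bar> \<le> norm (l *\<^sub>R n + d s)" if s: "\<bar>s\<bar> \<le> 1/2" and l: "\<bar>l\<bar> < m / 2" for s l
  proof (cases "\<bar>s\<bar> < \<delta>")
    case True
    \<comment> \<open>Pairing with \<open>w\<close> removes the normal term
      \<open>l *\<^sub>R n\<close>.\<close>
    have "norm w * (norm w * \<bar>s\<bar>) = norm ((s *\<^sub>R w) \<bullet> w)"
      by (simp add: abs_mult power2_norm_eq_inner[symmetric] power2_eq_square)
    also have "(s *\<^sub>R w) \<bullet> w = (d s + s *\<^sub>R w) \<bullet> w - (l *\<^sub>R n + d s) \<bullet> w"
      using n by (simp add: inner_left_distrib inner_commute[of n])
    also have "norm \<dots> \<le> norm ((d s + s *\<^sub>R w) \<bullet> w) + norm ((l *\<^sub>R n + d s) \<bullet> w)"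
      by (rule norm_triangle_ineq4)
    also have "\<dots> \<le> norm (d s + s *\<^sub>R w) * norm w + norm (l *\<^sub>R n + d s) * norm w"
      unfolding real_norm_def by (intro add_mono Cauchy_Schwarz_ineq2)
    also have "\<dots> \<le> norm w / 2 * \<bar>s\<bar> * norm w + norm (l *\<^sub>R n + d s) * norm w"
      by (intro add_right_mono mult_right_mono lin True) auto
    finally have "norm w * (norm w / 2 * \<bar>s\<bar>) \<le> norm w * norm (l *\<^sub>R n + d s)"
      by (simp add: algebra_simps)
    then have "norm w / 2 * \<bar>s\<bar> \<le> norm (l *\<^sub>R n + d s)" using w by (simp only: mult_le_cancel_left) auto
    moreover have "c * \<bar>s\<bar> \<le> norm w / 2 * \<bar>s\<bar>" unfolding c_def by (intro mult_right_mono) auto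
    ultimately show ?thesis by simp
  next
    case False
    have "m \<le> norm (d s)" using False by (intro m(2) far s) auto
    also have "\<dots> \<le> norm (l *\<^sub>R n + d s) + norm (l *\<^sub>R n)"
      by (metis add_diff_cancel_left' norm_triangle_ineq4)
    finally have "m / 2 \<le> norm (l *\<^sub>R n + d s)" using l n by simp
    moreover have "c * \<bar>s\<bar> \<le> m * (1/2)" unfolding c_def using m s by (intro mult_mono) auto
    ultimately show ?thesis by simp
  qed
  \<comment> \<open>With N = \<open>norm (l *\<^sub>R n + d s)\<close>, |l| is at most N + L |s|,
    hence at most N + (L / c) N; this determines the constant.\<close>
  have normal: "c / (c + L) * \<bar>l\<bar> \<le> norm (l *\<^sub>R n + d s)" if s: "\<bar>s\<bar> \<le> 1/2" and l: "\<bar>l\<bar> < m / 2" for s l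
  proof -
    have "\<bar>l\<bar> = norm (l *\<^sub>R n)" using n by simp
    also have "\<dots> \<le> norm (l *\<^sub>R n + d s) + norm (d s)"
      by (metis add_diff_cancel_right' norm_triangle_ineq4)
    finally have "c * \<bar>l\<bar> \<le> c * norm (l *\<^sub>R n + d s) + c * (L * \<bar>s\<bar>)"
      using L[OF s] c by (smt (verit) distrib_left mult_left_mono)
    also have "\<dots> \<le> c * norm (l *\<^sub>R n + d s) + L * norm (l *\<^sub>R n + d s)"
      using mult_left_mono[OF tangential[OF s l], of L] Lpos by (simp add: mult_ac)
    finally show ?thesis using c Lpos by (simp add: field_simps)
  qed
  define c' where "c' = min c (c / (c + L))"
  have c': "c' * x \<le> c * x" "c' * x \<le> c / (c + L) * x" if "x \<ge> 0" for x
    unfolding c'_def using that by (intro mult_right_mono; simp)+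
  show ?thesis
  proof (rule that)
    show "c' > 0" "m / 2 > 0" using c Lpos m(1) by (simp_all add: c'_def)
  qed (rule order_trans[OF c'(1) tangential] order_trans[OF c'(2) normal]; simp)+
qed

section \<open>The explicit integral along the tangent line\<close>

text \<open>This is what the singular part becomes after rescaling, with the curve replaced by its
  tangent line. The component along \<open>w\<close> is odd and contributes nothing; the one along
  \<open>n\<close> has an antiderivative that runs from -1/v to 1/v, where v is the norm of
  \<open>w\<close>.\<close>

lemma integral_inverse_cube_profile:
  fixes n w :: "'a :: euclidean_space"
  assumes n: "norm n = 1" "w \<bullet> n = 0" and w: "w \<noteq> 0"
  shows "(LINT \<sigma>|lborel. (1 / norm (n - \<sigma> *\<^sub>R w) ^ 3) *\<^sub>R (n - \<sigma> *\<^sub>R w)) = (2 / norm w) *\<^sub>R n"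
proof -
  define v where "v = norm w"
  have v: "v > 0" using w by (simp add: v_def)
  have nrm2: "(norm (n - \<sigma> *\<^sub>R w))\<^sup>2 = 1 + (v * \<sigma>)\<^sup>2" for \<sigma>
    using n by (simp add: power2_norm_eq_inner inner_simps v_def norm_eq_1 inner_commute
      power_mult_distrib) (simp add: power2_eq_square)
  have nrm: "norm (n - \<sigma> *\<^sub>R w) = sqrt (1 + (v * \<sigma>)\<^sup>2)" for \<sigma>
    by (metis nrm2 norm_ge_zero real_sqrt_unique)
  have pos: "sqrt (1 + (v * \<sigma>)\<^sup>2) > 0" "1 + (v * \<sigma>)\<^sup>2 > 0" for \<sigma>
    by (auto simp: add_pos_nonneg)
  define f where "f \<sigma> = (1 / norm (n - \<sigma> *\<^sub>R w) ^ 3) *\<^sub>R (n - \<sigma> *\<^sub>R w)" for \<sigma>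
  \<comment> \<open>The coefficients are antiderivatives of \<open>1 / r ^ 3\<close> and
    \<open>- \<sigma> / r ^ 3\<close>, where r is the square root, that is, the norm of
    \<open>n - \<sigma> *\<^sub>R w\<close>.\<close>
  define F where "F \<sigma> = (\<sigma> / sqrt (1 + (v * \<sigma>)\<^sup>2)) *\<^sub>R n + (1 / (v\<^sup>2 * sqrt (1 + (v * \<sigma>)\<^sup>2))) *\<^sub>R w" for \<sigma>
  have contf: "continuous_on UNIV f"
    unfolding f_def using pos by (intro continuous_intros) (auto simp: nrm less_imp_neq[symmetric])
  \<comment> \<open>Absolute integrability on the whole line is read off from this norm.\<close>
  have nf: "norm (f \<sigma>) = inverse (1 + (v * \<sigma>)\<^sup>2)" for \<sigma>
  proof -
    have "norm (n - \<sigma> *\<^sub>R w) > 0" using pos nrm by simp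
    then have "norm (f \<sigma>) = inverse ((norm (n - \<sigma> *\<^sub>R w))\<^sup>2)"
      unfolding f_def norm_scaleR by (auto simp: divide_simps power2_eq_square power3_eq_cube)
    then show ?thesis using nrm2 by simp
  qed
  have "integrable lborel (\<lambda>\<sigma>. inverse (1 + \<sigma>\<^sup>2) :: real)"
    using integrable_inverse_1_plus_square by (simp add: set_integrable_def)
  from lborel_integrable_real_affine[OF this, of v 0]
  have "integrable lborel (\<lambda>\<sigma>. inverse (1 + (v * \<sigma>)\<^sup>2))" using v by simp
  then have intf: "integrable lborel f"
    by (rule Bochner_Integration.integrable_bound)
       (use nf borel_measurable_continuous_onI[OF contf] pos in \<open>auto simp: less_imp_le\<close>)
  have deriv: "(F has_vector_derivative f \<sigma>) (at \<sigma>)" for \<sigma>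
  proof -
    define r where "r = sqrt (1 + (v * \<sigma>)\<^sup>2)"
    have r: "r > 0" "r\<^sup>2 = 1 + v\<^sup>2 * \<sigma>\<^sup>2" using pos[of \<sigma>] by (simp_all add: r_def power_mult_distrib)
    have 0: "((\<lambda>\<sigma>. sqrt (1 + (v * \<sigma>)\<^sup>2)) has_real_derivative v\<^sup>2 * \<sigma> / r) (at \<sigma>)"
    proof -
      have "((\<lambda>\<sigma>. 1 + (v * \<sigma>)\<^sup>2) has_real_derivative 2 * (v\<^sup>2 * \<sigma>)) (at \<sigma>)"
        by (auto intro!: derivative_eq_intros simp: power2_eq_square)
      moreover have "inverse r / 2 * (2 * (v\<^sup>2 * \<sigma>)) = v\<^sup>2 * \<sigma> / r" using r(1) by (simp add: field_simps)
      ultimately show ?thesis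
        using DERIV_chain2[where f = sqrt and g = "\<lambda>\<sigma>. 1 + (v * \<sigma>)\<^sup>2" and x = \<sigma> and s = UNIV, OF DERIV_real_sqrt[OF pos(2)]]
        unfolding r_def by metis
    qed
    have "r - \<sigma> * (v\<^sup>2 * \<sigma> / r) = (r\<^sup>2 - v\<^sup>2 * \<sigma>\<^sup>2) / r"
      using r(1) by (simp add: diff_divide_distrib power2_eq_square)
    then have eq: "(1 * r - \<sigma> * (v\<^sup>2 * \<sigma> / r)) / (r * r) = 1 / r ^ 3"
      using r by (simp add: power3_eq_cube)
    have 1: "((\<lambda>\<sigma>. \<sigma> / sqrt (1 + (v * \<sigma>)\<^sup>2)) has_real_derivative 1 / r ^ 3) (at \<sigma>)"
      using DERIV_divide[OF DERIV_ident 0] pos[of \<sigma>] unfolding r_def[symmetric] eq by simp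
    have "- (v\<^sup>2 * (v\<^sup>2 * \<sigma> / r)) / (v\<^sup>2 * r)\<^sup>2 = - \<sigma> / r ^ 3"
      using r(1) v by (simp add: power2_eq_square power3_eq_cube)
    moreover have "((\<lambda>\<sigma>. inverse (v\<^sup>2 * sqrt (1 + (v * \<sigma>)\<^sup>2))) has_real_derivative
        - (v\<^sup>2 * (v\<^sup>2 * \<sigma> / r)) / (v\<^sup>2 * r)\<^sup>2) (at \<sigma>)"
    proof -
      have *: "- (inverse (v\<^sup>2 * r) * (v\<^sup>2 * (v\<^sup>2 * \<sigma> / r)) * inverse (v\<^sup>2 * r)) =
          - (v\<^sup>2 * (v\<^sup>2 * \<sigma> / r)) / (v\<^sup>2 * r)\<^sup>2"
        using r(1) v by (simp add: field_simps power2_eq_square)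
      have "v\<^sup>2 * sqrt (1 + (v * \<sigma>)\<^sup>2) \<noteq> 0" using r(1) v by (simp add: r_def)
      from DERIV_inverse'[OF DERIV_cmult[OF 0, of "v\<^sup>2"] this] show ?thesis
        unfolding r_def[symmetric] * .
    qed
    ultimately have 2: "((\<lambda>\<sigma>. 1 / (v\<^sup>2 * sqrt (1 + (v * \<sigma>)\<^sup>2))) has_real_derivative - \<sigma> / r ^ 3) (at \<sigma>)"
      by (simp add: inverse_eq_divide)
    show ?thesis unfolding F_def f_def nrm r_def[symmetric]
      by (rule has_vector_derivative_eq_rhs, (rule derivative_intros 1 2)+)
         (simp add: scaleR_diff_right)
  qed
  have "(LBINT x=-\<infinity>..\<infinity>. f x) = (1 / v) *\<^sub>R n - (- 1 / v) *\<^sub>R n"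
  proof (rule interval_integral_FTC_integrable[where F = F])
    have lim: "((\<lambda>\<sigma>. \<sigma> / sqrt (1 + (v * \<sigma>)\<^sup>2)) \<longlongrightarrow> 1 / v) at_top"
      "((\<lambda>\<sigma>. \<sigma> / sqrt (1 + (v * \<sigma>)\<^sup>2)) \<longlongrightarrow> - 1 / v) at_bot"
      "((\<lambda>\<sigma>. 1 / (v\<^sup>2 * sqrt (1 + (v * \<sigma>)\<^sup>2))) \<longlongrightarrow> 0) at_top"
      "((\<lambda>\<sigma>. 1 / (v\<^sup>2 * sqrt (1 + (v * \<sigma>)\<^sup>2))) \<longlongrightarrow> 0) at_bot"
      using v by - (real_asymp; simp add: inverse_eq_divide)+
    have "(F \<longlongrightarrow> (- 1 / v) *\<^sub>R n + 0 *\<^sub>R w) at_bot" "(F \<longlongrightarrow> (1 / v) *\<^sub>R n + 0 *\<^sub>R w) at_top"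
      unfolding F_def by (intro tendsto_intros lim)+
    then show "((F \<circ> real_of_ereal) \<longlongrightarrow> (- 1 / v) *\<^sub>R n) (at_right (-\<infinity>))"
      "((F \<circ> real_of_ereal) \<longlongrightarrow> (1 / v) *\<^sub>R n) (at_left \<infinity>)"
      by (simp_all add: ereal_tendsto_simps)
  qed (use deriv contf intf in \<open>auto simp: set_integrable_def continuous_on_eq_continuous_at\<close>)
  also have "\<dots> = (2 / v) *\<^sub>R n" by (simp flip: scaleR_diff_left scaleR_add_left)
  finally show ?thesis by (simp add: interval_lebesgue_integral_def set_lebesgue_integral_def f_def v_def)
qed

section \<open>Two-sided limits at 0\<close>

text \<open>The limit is tested along sequences in the punctured ball of radius \<open>r\<close>, so
  that the sequential theorem applies and domination is asked for only when 0 < |l| < r.\<close>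

lemma dominated_convergence_at_0:
  fixes f :: "real \<Rightarrow> 'b \<Rightarrow> 'a :: {banach, second_countable_topology}"
  assumes "r > 0" and "integrable M w"
    and "\<And>l. f l \<in> borel_measurable M" and "f' \<in> borel_measurable M"
    and "\<And>x. ((\<lambda>l. f l x) \<longlongrightarrow> f' x) (at 0)"
    and "\<And>l x. l \<noteq> 0 \<Longrightarrow> \<bar>l\<bar> < r \<Longrightarrow> norm (f l x) \<le> w x"
  shows "((\<lambda>l. integral\<^sup>L M (f l)) \<longlongrightarrow> integral\<^sup>L M f') (at 0)"
proof -
  have eq: "at (0::real) = at 0 within ball 0 r" using assms(1) by (subst at_within_open) auto
  show ?thesis
    unfolding eq tendsto_at_iff_sequentially
  proof (intro allI impI)
    fix X :: "nat \<Rightarrow> real"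
    assume X: "\<forall>i. X i \<in> ball 0 r - {0}" "X \<longlonglongrightarrow> 0"
    have "(\<lambda>i. f (X i) x) \<longlonglongrightarrow> f' x" for x
      using assms(5)[of x] X unfolding eq tendsto_at_iff_sequentially by (auto simp: comp_def)
    then show "((\<lambda>l. integral\<^sup>L M (f l)) \<circ> X) \<longlonglongrightarrow> integral\<^sup>L M f'"
      unfolding comp_def
      by (intro integral_dominated_convergence[where w = w] assms) (use X assms in auto)
  qed
qed

lemma has_vector_derivative_quotient_tendsto:
  fixes f :: "real \<Rightarrow> 'a :: real_normed_vector"
  assumes "(f has_vector_derivative f') (at 0)" "f 0 = 0"
  shows "((\<lambda>l. f l /\<^sub>R l) \<longlongrightarrow> f') (at 0)"
proof -
  have "((\<lambda>l. norm (f l - l *\<^sub>R f') / \<bar>l\<bar>) \<longlongrightarrow> 0) (at 0)"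
    using assms unfolding has_vector_derivative_def has_derivative_iff_norm by simp
  moreover have "\<forall>\<^sub>F l in at 0. norm (f l - l *\<^sub>R f') / \<bar>l\<bar> = norm (f l /\<^sub>R l - f')"
    unfolding eventually_at_filter
  proof (intro always_eventually allI impI)
    fix l :: real assume "l \<noteq> 0"
    then have "f l /\<^sub>R l - f' = (1 / l) *\<^sub>R (f l - l *\<^sub>R f')" by (simp add: scaleR_diff_right inverse_eq_divide)
    then show "norm (f l - l *\<^sub>R f') / \<bar>l\<bar> = norm (f l /\<^sub>R l - f')" by simp
  qed
  ultimately have "((\<lambda>l. norm (f l /\<^sub>R l - f')) \<longlongrightarrow> 0) (at 0)"
    by (rule Lim_transform_eventually)
  from tendsto_norm_zero_cancel[OF this] show ?thesis by (rule LIM_zero_cancel)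
qed

section \<open>Limit of the offset integral for an abstract chord and density\<close>

text \<open>The assumptions isolate what the limit argument takes from the curve. The range |s|
  \<le> 1/2 is one period with the base point in its middle, so the singularity never sits at an
  endpoint. The quadratic bound in the last assumption is what tames the second summand of the
  kernel.\<close>

locale offset_integral =
  fixes d g :: "real \<Rightarrow> 'a :: euclidean_space" and n w :: 'a and c r G C :: real
  assumes deriv: "(d has_vector_derivative - w) (at 0)" and d0: "d 0 = 0"
    and cont_d: "continuous_on UNIV d" and cont_g: "continuous_on UNIV g"
    and w: "w \<noteq> 0" and n: "norm n = 1" "w \<bullet> n = 0"
    and cr: "c > 0" "r > 0"
    and ge_s: "\<And>s l. \<bar>s\<bar> \<le> 1/2 \<Longrightarrow> \<bar>l\<bar> < r \<Longrightarrow> c * \<bar>s\<bar> \<le> norm (l *\<^sub>R n + d s)"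
    and ge_l: "\<And>s l. \<bar>s\<bar> \<le> 1/2 \<Longrightarrow> \<bar>l\<bar> < r \<Longrightarrow> c * \<bar>l\<bar> \<le> norm (l *\<^sub>R n + d s)"
    and g_le: "\<And>s. \<bar>s\<bar> \<le> 1/2 \<Longrightarrow> norm (g s) \<le> G"
    and dg_le: "\<And>s. \<bar>s\<bar> \<le> 1/2 \<Longrightarrow> \<bar>d s \<bullet> g s\<bar> \<le> C * s\<^sup>2"
begin

text \<open>The part whose mass concentrates at \<open>s = 0\<close> as \<open>l\<close> tends to 0.
  Its factor \<open>l\<close> makes it vanish identically at \<open>l = 0\<close>, so there the
  whole kernel is \<open>regular 0\<close>.\<close>

definition singular :: "real \<Rightarrow> real \<Rightarrow> 'a" where
  "singular l s = (l * (n \<bullet> g s) / norm (l *\<^sub>R n + d s) ^ 3) *\<^sub>R (l *\<^sub>R n + d s)"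

definition regular :: "real \<Rightarrow> real \<Rightarrow> 'a" where
  "regular l s = ((d s \<bullet> g s) / norm (l *\<^sub>R n + d s) ^ 3) *\<^sub>R (l *\<^sub>R n + d s)"

lemma singular_plus_regular:
  "singular l s + regular l s =
    (((l *\<^sub>R n + d s) \<bullet> g s) / norm (l *\<^sub>R n + d s) ^ 3) *\<^sub>R (l *\<^sub>R n + d s)"
  by (simp add: singular_def regular_def inner_left_distrib add_divide_distrib flip: scaleR_add_left)

lemma measurable_d [measurable]: "d \<in> borel_measurable borel"
  using cont_d by (rule borel_measurable_continuous_onI)

lemma measurable_g [measurable]: "g \<in> borel_measurable borel"
  using cont_g by (rule borel_measurable_continuous_onI)

lemma measurable_singular [measurable]: "singular l \<in> borel_measurable borel"
  unfolding singular_def by measurable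

lemma measurable_regular [measurable]: "regular l \<in> borel_measurable borel"
  unfolding regular_def by measurable

lemma G_nonneg: "G \<ge> 0"
  using g_le[of 0] norm_ge_zero[of "g 0"] by linarith

text \<open>Averaging the squares of the two lower bounds gives at least
  \<open>c\<^sup>2 * (l\<^sup>2 + s\<^sup>2) / 2\<close> for the squared distance. The result is a
  multiple of the Poisson kernel in \<open>s\<close>, whose integral stays bounded as
  \<open>l\<close> tends to 0.\<close>

lemma norm_singular_le:
  assumes s: "\<bar>s\<bar> \<le> 1/2" and l: "l \<noteq> 0" "\<bar>l\<bar> < r"
  shows "norm (singular l s) \<le> 2 * \<bar>l\<bar> * G / (c\<^sup>2 * (l\<^sup>2 + s\<^sup>2))"
proof -
  define R where "R = norm (l *\<^sub>R n + d s)"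
  have "(c * \<bar>s\<bar>)\<^sup>2 \<le> R\<^sup>2" "(c * \<bar>l\<bar>)\<^sup>2 \<le> R\<^sup>2"
    unfolding R_def using ge_s[OF s l(2)] ge_l[OF s l(2)] cr by (auto intro!: power_mono)
  then have R2: "c\<^sup>2 * (l\<^sup>2 + s\<^sup>2) \<le> 2 * R\<^sup>2" by (simp add: power_mult_distrib algebra_simps)
  have pos: "c\<^sup>2 * (l\<^sup>2 + s\<^sup>2) > 0" using cr l by (simp add: add_pos_nonneg)
  have "R \<noteq> 0" using R2 pos by auto
  then have R: "R > 0" by (simp add: R_def)
  have "\<bar>n \<bullet> g s\<bar> \<le> G" using Cauchy_Schwarz_ineq2[of n "g s"] n g_le[OF s] by simp
  have "norm (singular l s) = \<bar>l\<bar> * \<bar>n \<bullet> g s\<bar> / R\<^sup>2"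
    using R unfolding singular_def R_def[symmetric] norm_scaleR
    by (simp add: abs_mult power2_eq_square power3_eq_cube)
  also have "\<dots> \<le> \<bar>l\<bar> * G / R\<^sup>2"
    using \<open>\<bar>n \<bullet> g s\<bar> \<le> G\<close> by (intro divide_right_mono mult_left_mono) auto
  also have "\<dots> \<le> \<bar>l\<bar> * G / (c\<^sup>2 * (l\<^sup>2 + s\<^sup>2) / 2)"
    using R2 pos R G_nonneg by (intro divide_left_mono) auto
  also have "\<dots> = 2 * \<bar>l\<bar> * G / (c\<^sup>2 * (l\<^sup>2 + s\<^sup>2))" by simp
  finally show ?thesis .
qed

text \<open>The quadratic bound on \<open>d s \<bullet> g s\<close> cancels against the squared
  distance, which is at least \<open>(c * \<bar>s\<bar>)\<^sup>2\<close>. The bound is uniform in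
  \<open>l\<close> and includes \<open>l = 0\<close>.\<close>

lemma norm_regular_le:
  assumes s: "\<bar>s\<bar> \<le> 1/2" and l: "\<bar>l\<bar> < r"
  shows "norm (regular l s) \<le> C / c\<^sup>2"
proof (cases "s = 0")
  case True
  \<comment> \<open>At \<open>s = 0\<close> the quadratic bound says nothing about the sign of
    \<open>C\<close>, so it is evaluated at 1/2.\<close>
  have "0 \<le> C" using dg_le[of "1/2"] by (simp add: power2_eq_square)
  then show ?thesis using True cr by (simp add: regular_def d0)
next
  case False
  define R where "R = norm (l *\<^sub>R n + d s)"
  have le: "c * \<bar>s\<bar> \<le> R" unfolding R_def by (rule ge_s[OF s l])
  have cs: "c * \<bar>s\<bar> > 0" using False cr by simp
  then have R: "R > 0" using le by linarith
  have C: "0 \<le> C * s\<^sup>2" using dg_le[OF s] by linarith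
  have "norm (regular l s) = \<bar>d s \<bullet> g s\<bar> / R\<^sup>2"
    using R unfolding regular_def R_def[symmetric] norm_scaleR
    by (simp add: abs_mult power2_eq_square power3_eq_cube)
  also have "\<dots> \<le> C * s\<^sup>2 / R\<^sup>2" using dg_le[OF s] by (intro divide_right_mono) auto
  also have "\<dots> \<le> C * s\<^sup>2 / (c * \<bar>s\<bar>)\<^sup>2"
    using C le zero_less_power[OF R, of 2] zero_less_power[OF cs, of 2] cs
    by (intro divide_left_mono power_mono mult_pos_pos) linarith+
  also have "\<dots> = C / c\<^sup>2" using False by (simp add: power_mult_distrib)
  finally show ?thesis .
qed

lemma set_integrable_bounded_near:
  fixes f :: "real \<Rightarrow> 'a"
  assumes [measurable]: "f \<in> borel_measurable borel" and "\<And>s. \<bar>s\<bar> \<le> 1/2 \<Longrightarrow> norm (f s) \<le> B"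
  shows "set_integrable lborel {-1/2..1/2} f"
  unfolding set_integrable_def
  by (rule integrableI_bounded_set_indicator[where B = B])
     (auto simp: emeasure_lborel_Icc_eq abs_le_iff intro!: assms)

text \<open>Dropping \<open>s\<^sup>2\<close> from the denominator loses uniformity in
  \<open>l\<close> but gives a constant in \<open>s\<close>, which is enough for integrability at a
  fixed \<open>l\<close>.\<close>

lemma norm_singular_le_const:
  assumes s: "\<bar>s\<bar> \<le> 1/2" and l: "l \<noteq> 0" "\<bar>l\<bar> < r"
  shows "norm (singular l s) \<le> 2 * \<bar>l\<bar> * G / (c\<^sup>2 * l\<^sup>2)"
proof -
  have "norm (singular l s) \<le> 2 * \<bar>l\<bar> * G / (c\<^sup>2 * (l\<^sup>2 + s\<^sup>2))" by (rule norm_singular_le[OF s l])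
  also have "\<dots> \<le> 2 * \<bar>l\<bar> * G / (c\<^sup>2 * l\<^sup>2)"
    using l cr G_nonneg by (intro divide_left_mono mult_left_mono) (auto simp: add_pos_nonneg)
  finally show ?thesis .
qed

lemma set_integrable_singular:
  "l \<noteq> 0 \<Longrightarrow> \<bar>l\<bar> < r \<Longrightarrow> set_integrable lborel {-1/2..1/2} (singular l)"
  by (rule set_integrable_bounded_near[OF _ norm_singular_le_const]) auto

lemma kernel_bounded:
  assumes l: "\<bar>l\<bar> < r"
  obtains B where "\<And>s. \<bar>s\<bar> \<le> 1/2 \<Longrightarrow> norm (singular l s + regular l s) \<le> B"
proof (cases "l = 0")
  case True
  then show ?thesis using norm_regular_le[OF _ l] by (intro that[of "C / c\<^sup>2"]) (simp add: singular_def)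
next
  case False
  show ?thesis
    by (rule that, rule norm_triangle_mono[OF norm_singular_le_const[OF _ False l] norm_regular_le[OF _ l]])
qed

lemma set_integrable_regular:
  "\<bar>l\<bar> < r \<Longrightarrow> set_integrable lborel {-1/2..1/2} (regular l)"
  by (rule set_integrable_bounded_near[OF _ norm_regular_le]) auto

text \<open>The constant bound dominates. Pointwise, the lower bound at \<open>l = 0\<close> shows
  that \<open>d s\<close> is nonzero for \<open>s \<noteq> 0\<close> in the interval, so the
  integrand is continuous in \<open>l\<close> at 0; for \<open>s = 0\<close> it vanishes.\<close>

lemma regular_tendsto:
  "((\<lambda>l. LINT s:{-1/2..1/2}|lborel. regular l s) \<longlongrightarrow> (LINT s:{-1/2..1/2}|lborel. regular 0 s)) (at 0)"
  unfolding set_lebesgue_integral_def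
proof (rule dominated_convergence_at_0[OF cr(2), where w = "\<lambda>s. indicator {-1/2..1/2} s * (C / c\<^sup>2)"])
  show "integrable lborel (\<lambda>s. indicator {- 1 / 2..1 / 2 :: real} s * (C / c\<^sup>2))"
    by (auto simp: emeasure_lborel_Icc_eq intro!: integrable_mult_left)
next
  fix s :: real
  have "((\<lambda>l. regular l s) \<longlongrightarrow> regular 0 s) (at 0)" if s: "\<bar>s\<bar> \<le> 1/2"
  proof (cases "s = 0")
    case True
    then show ?thesis by (simp add: regular_def d0)
  next
    case False
    with s have "c * \<bar>s\<bar> \<le> norm (d s)" "c * \<bar>s\<bar> > 0" using ge_s[OF s, of 0] cr by auto
    then have "d s \<noteq> 0" by auto
    then show ?thesis unfolding regular_def by (auto intro!: tendsto_eq_intros)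
  qed
  then show "((\<lambda>l. indicator {- 1 / 2..1 / 2} s *\<^sub>R regular l s) \<longlongrightarrow>
      indicator {- 1 / 2..1 / 2} s *\<^sub>R regular 0 s) (at 0)"
    by (auto simp: indicator_def abs_le_iff)
qed (auto simp: indicator_def abs_le_iff intro!: norm_regular_le)

text \<open>Under \<open>s = l * \<sigma>\<close> the vector \<open>l *\<^sub>R n + d s\<close> is
  \<open>l\<close> times \<open>q l\<close>, and \<open>q l\<close> tends to
  \<open>n - \<sigma> *\<^sub>R w\<close> because the difference quotient of the chord does. The
  factor |l| is the Jacobian of the substitution.\<close>

lemma rescaled_singular_tendsto:
  "((\<lambda>l. \<bar>l\<bar> *\<^sub>R singular l (l * \<sigma>)) \<longlongrightarrow>
      ((n \<bullet> g 0) / norm (n - \<sigma> *\<^sub>R w) ^ 3) *\<^sub>R (n - \<sigma> *\<^sub>R w)) (at 0)"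
proof -
  define q where "q l = n + d (l * \<sigma>) /\<^sub>R l" for l
  have "((d \<circ> (\<lambda>l. l * \<sigma>)) has_vector_derivative \<sigma> *\<^sub>R (- w)) (at 0)"
    using deriv by (intro vector_diff_chain_at) (auto intro!: derivative_eq_intros)
  from has_vector_derivative_quotient_tendsto[OF this]
  have "(q \<longlongrightarrow> n + \<sigma> *\<^sub>R (- w)) (at 0)" 
    unfolding q_def comp_def by (intro tendsto_add tendsto_const) (simp add: d0)
  then have q: "(q \<longlongrightarrow> n - \<sigma> *\<^sub>R w) (at 0)" by simp
  \<comment> \<open>The limiting denominator is nonzero because the normal component is 1.\<close>
  have "(n - \<sigma> *\<^sub>R w) \<bullet> n = 1" using n by (simp add: inner_diff_left norm_eq_1)
  then have nz: "n - \<sigma> *\<^sub>R w \<noteq> 0" by auto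
  have "isCont g 0" using cont_g by (simp add: continuous_on_eq_continuous_at)
  then have g: "((\<lambda>l. g (l * \<sigma>)) \<longlongrightarrow> g 0) (at 0)"
    by (rule isCont_tendsto_compose) (auto intro!: tendsto_eq_intros)
  have "((\<lambda>l. ((n \<bullet> g (l * \<sigma>)) / norm (q l) ^ 3) *\<^sub>R q l) \<longlongrightarrow>
      ((n \<bullet> g 0) / norm (n - \<sigma> *\<^sub>R w) ^ 3) *\<^sub>R (n - \<sigma> *\<^sub>R w)) (at 0)"
    by (intro tendsto_intros q g) (use nz in auto)
  moreover have "\<forall>\<^sub>F l in at 0. ((n \<bullet> g (l * \<sigma>)) / norm (q l) ^ 3) *\<^sub>R q l = \<bar>l\<bar> *\<^sub>R singular l (l * \<sigma>)"
    unfolding eventually_at_filter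
  proof (intro always_eventually allI impI)
    fix l :: real assume l: "l \<noteq> 0"
    then have lq: "l *\<^sub>R n + d (l * \<sigma>) = l *\<^sub>R q l" by (simp add: q_def scaleR_add_right)
    \<comment> \<open>The two signed factors \<open>l\<close> multiply to a square, so no sign of
      \<open>l\<close> survives and both one-sided limits agree.\<close>
    have *: "\<bar>l\<bar> * (l * x / (\<bar>l\<bar> * y) ^ 3 * l) = x / y ^ 3" for x y
      using l by (cases "y = 0") (auto simp: power3_eq_cube field_simps abs_if)
    show "((n \<bullet> g (l * \<sigma>)) / norm (q l) ^ 3) *\<^sub>R q l = \<bar>l\<bar> *\<^sub>R singular l (l * \<sigma>)"
      unfolding singular_def lq norm_scaleR scaleR_scaleR mult.assoc by (simp only: *)
  qed
  ultimately show ?thesis by (rule Lim_transform_eventually)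
qed

lemma singular_integral_tendsto:
  "((\<lambda>l. LINT s:{-1/2..1/2}|lborel. singular l s) \<longlongrightarrow> (2 * (n \<bullet> g 0) / norm w) *\<^sub>R n) (at 0)"
proof -
  \<comment> \<open>\<open>H l\<close> is the integrand after the substitution, extended by zero so
    that all integrals are over the same line; \<open>P\<close> is its pointwise limit.\<close>
  define H where "H l \<sigma> = indicator {-1/2..1/2} (l * \<sigma>) *\<^sub>R (\<bar>l\<bar> *\<^sub>R singular l (l * \<sigma>))" for l \<sigma>
  define P where "P \<sigma> = ((n \<bullet> g 0) / norm (n - \<sigma> *\<^sub>R w) ^ 3) *\<^sub>R (n - \<sigma> *\<^sub>R w)" for \<sigma>
  have P: "integral\<^sup>L lborel P = (2 * (n \<bullet> g 0) / norm w) *\<^sub>R n"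
  proof -
    have "integral\<^sup>L lborel P =
        (LINT \<sigma>|lborel. (n \<bullet> g 0) *\<^sub>R ((1 / norm (n - \<sigma> *\<^sub>R w) ^ 3) *\<^sub>R (n - \<sigma> *\<^sub>R w)))"
      unfolding P_def scaleR_scaleR by (simp only: mult_1_right times_divide_eq_right)
    also have "\<dots> = (n \<bullet> g 0) *\<^sub>R ((2 / norm w) *\<^sub>R n)"
      by (simp only: integral_scaleR_right integral_inverse_cube_profile[OF n w])
    finally show ?thesis by (simp add: mult_ac)
  qed
  have "((\<lambda>l. integral\<^sup>L lborel (H l)) \<longlongrightarrow> integral\<^sup>L lborel P) (at 0)"
  proof (rule dominated_convergence_at_0[OF cr(2), where w = "\<lambda>\<sigma>. 2 * G / c\<^sup>2 * inverse (1 + \<sigma>\<^sup>2)"])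
    show "integrable lborel (\<lambda>\<sigma>. 2 * G / c\<^sup>2 * inverse (1 + \<sigma>\<^sup>2))"
      using integrable_inverse_1_plus_square by (simp add: set_integrable_def)
    show "H l \<in> borel_measurable lborel" for l
      unfolding H_def by measurable
    show "P \<in> borel_measurable lborel"
      unfolding P_def by measurable
    show "((\<lambda>l. H l \<sigma>) \<longlongrightarrow> P \<sigma>) (at 0)" for \<sigma>
    proof (rule Lim_transform_eventually[OF rescaled_singular_tendsto[of \<sigma>, folded P_def]])
      \<comment> \<open>For a fixed \<sigma> the indicator in \<open>H\<close> is eventually
        1.\<close>
      have "((\<lambda>l. \<bar>l * \<sigma>\<bar>) \<longlongrightarrow> 0) (at 0)" by (auto intro!: tendsto_eq_intros)
      then have "\<forall>\<^sub>F l in at 0. \<bar>l * \<sigma>\<bar> < 1/2" by (rule order_tendstoD) simp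
      then show "\<forall>\<^sub>F l in at 0. \<bar>l\<bar> *\<^sub>R singular l (l * \<sigma>) = H l \<sigma>"
        by eventually_elim (auto simp: H_def indicator_def)
    qed
    show "norm (H l \<sigma>) \<le> 2 * G / c\<^sup>2 * inverse (1 + \<sigma>\<^sup>2)" if l: "l \<noteq> 0" "\<bar>l\<bar> < r" for l \<sigma>
    proof (cases "\<bar>l * \<sigma>\<bar> \<le> 1/2")
      case True
      have "norm (H l \<sigma>) \<le> \<bar>l\<bar> * norm (singular l (l * \<sigma>))"
        by (simp add: H_def indicator_def)
      \<comment> \<open>The Jacobian supplies the second factor |l|, so that \<open>l\<close>
        cancels and the majorant depends on \<sigma> alone.\<close>
      also have "\<dots> \<le> \<bar>l\<bar> * (2 * \<bar>l\<bar> * G / (c\<^sup>2 * (l\<^sup>2 + (l * \<sigma>)\<^sup>2)))"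
        by (intro mult_left_mono norm_singular_le True l) auto
      also have "\<dots> = (2 * G * l\<^sup>2) / (c\<^sup>2 * (1 + \<sigma>\<^sup>2) * l\<^sup>2)"
        by (simp add: power_mult_distrib algebra_simps) (simp add: power2_eq_square)
      also have "\<dots> = 2 * G / c\<^sup>2 * inverse (1 + \<sigma>\<^sup>2)"
        using l by (simp add: inverse_eq_divide)
      finally show ?thesis .
    next
      case False
      then have "H l \<sigma> = 0" by (auto simp: H_def indicator_def abs_le_iff)
      then show ?thesis using G_nonneg by (simp add: add_nonneg_nonneg)
    qed
  qed
  moreover have "\<forall>\<^sub>F l in at 0. integral\<^sup>L lborel (H l) = (LINT s:{-1/2..1/2}|lborel. singular l s)"
    unfolding eventually_at_filter
  proof (intro always_eventually allI impI)
    fix l :: real assume l: "l \<noteq> 0"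
    have "H l = (\<lambda>\<sigma>. \<bar>l\<bar> *\<^sub>R (indicator {-1/2..1/2} (l * \<sigma>) *\<^sub>R singular l (l * \<sigma>)))"
      by (simp add: H_def fun_eq_iff)
    then have "integral\<^sup>L lborel (H l) =
        \<bar>l\<bar> *\<^sub>R (LINT \<sigma>|lborel. indicator {-1/2..1/2} (l * \<sigma>) *\<^sub>R singular l (l * \<sigma>))"
      by (simp only: integral_scaleR_right)
    also have "\<dots> = (LINT s|lborel. indicator {-1/2..1/2} s *\<^sub>R singular l s)"
      using lborel_integral_real_affine[OF l, of "\<lambda>s. indicator {-1/2..1/2} s *\<^sub>R singular l s" 0] by simp
    finally show "integral\<^sup>L lborel (H l) = (LINT s:{-1/2..1/2}|lborel. singular l s)"
      by (simp add: set_lebesgue_integral_def)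
  qed
  ultimately show ?thesis unfolding P by (rule Lim_transform_eventually)
qed

lemma offset_integral_tendsto:
  "((\<lambda>l. LINT s:{-1/2..1/2}|lborel. singular l s + regular l s) \<longlongrightarrow>
     (2 * (n \<bullet> g 0) / norm w) *\<^sub>R n +
     (LINT s:{-1/2..1/2}|lborel. singular 0 s + regular 0 s)) (at 0)"
proof -
  have "\<forall>\<^sub>F l in at 0. \<bar>l\<bar> < r"
    using cr(2) by (auto simp: eventually_at intro!: exI[of _ r])
  moreover have "\<forall>\<^sub>F l :: real in at 0. l \<noteq> 0" by (simp add: eventually_at_filter)
  ultimately have "\<forall>\<^sub>F l in at 0. (LINT s:{-1/2..1/2}|lborel. singular l s) + (LINT s:{-1/2..1/2}|lborel. regular l s) =
      (LINT s:{-1/2..1/2}|lborel. singular l s + regular l s)"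
    by eventually_elim (intro set_integral_add(2)[symmetric] set_integrable_singular set_integrable_regular)
  from Lim_transform_eventually[OF tendsto_add[OF singular_integral_tendsto regular_tendsto] this]
  show ?thesis by (simp add: singular_def)
qed

end

section \<open>Plane geometry and the unit tangent\<close>

lemma norm_rot90 [simp]: "norm (rot90 v) = norm v"
  by (simp add: rot90_def norm_eq_sqrt_inner inner_vec_def sum_2 add.commute)

lemma inner_rot90 [simp]: "v \<bullet> rot90 v = 0"
  by (simp add: rot90_def inner_vec_def sum_2)

text \<open>In the plane, a vector orthogonal to \<open>w\<close> lies on the line of
  \<open>n\<close>: the residual \<open>y\<close> is orthogonal to both \<open>n\<close> and
  \<open>w\<close>, which are linearly independent.\<close>

lemma orthogonal_expansion_R2:
  fixes n w v :: "real^2"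
  assumes "norm n = 1" "w \<noteq> 0" "w \<bullet> n = 0" "w \<bullet> v = 0"
  shows "(n \<bullet> v) *\<^sub>R n = v"
proof -
  define y where "y = v - (n \<bullet> v) *\<^sub>R n"
  have y: "n \<bullet> y = 0" "w \<bullet> y = 0"
    using assms by (simp_all add: y_def inner_diff_right norm_eq_1)
  have "y $ 1 * (n $ 1 * w $ 2 - n $ 2 * w $ 1) = 0" "y $ 2 * (n $ 1 * w $ 2 - n $ 2 * w $ 1) = 0"
    using y by (simp_all add: inner_vec_def sum_2) algebra+
  \<comment> \<open>Lagrange's identity shows that the determinant of \<open>n\<close> and
    \<open>w\<close> is nonzero.\<close>
  moreover have "(n $ 1 * w $ 2 - n $ 2 * w $ 1)\<^sup>2 = (n \<bullet> n) * (w \<bullet> w) - (w \<bullet> n)\<^sup>2"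
    by (simp add: inner_vec_def sum_2) algebra
  then have "n $ 1 * w $ 2 - n $ 2 * w $ 1 \<noteq> 0"
    using assms by (auto simp: norm_eq_1)
  ultimately have "y = 0" by (simp add: vec_eq_iff forall_2)
  then show ?thesis by (simp add: y_def)
qed

text \<open>It follows the parametrization and, unlike \<open>tangent\<close>, carries no
  orientation sign.\<close>

definition unit_tangent :: "(real \<Rightarrow> real^2) \<Rightarrow> real \<Rightarrow> real^2" where
  "unit_tangent \<gamma> s = velocity \<gamma> s /\<^sub>R norm (velocity \<gamma> s)"

abbreviation tangent_deriv :: "(real \<Rightarrow> real^2) \<Rightarrow> real \<Rightarrow> real^2" where
  "tangent_deriv \<gamma> s \<equiv> vector_derivative (unit_tangent \<gamma>) (at s)"

lemma orientation_square [simp]: "orientation \<gamma> * orientation \<gamma> = 1"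
  by (simp add: orientation_def)

lemma tangent_eq: "tangent \<gamma> = (\<lambda>s. orientation \<gamma> *\<^sub>R unit_tangent \<gamma> s)"
  by (simp add: fun_eq_iff tangent_def unit_tangent_def divide_inverse)

section \<open>Calculus on a regular periodic parametrization\<close>

context
  fixes \<gamma> :: "real \<Rightarrow> real^2"
  assumes curve: "C2_Jordan_param \<gamma>"
begin

lemma has_velocity: "(\<gamma> has_vector_derivative velocity \<gamma> s) (at s)"
  using curve by (simp add: C2_Jordan_param_def C1_differentiable_on_eq vector_derivative_works)

lemma velocity_nonzero: "velocity \<gamma> s \<noteq> 0"
  using curve by (simp add: C2_Jordan_param_def)

lemma has_acceleration: "(velocity \<gamma> has_vector_derivative vector_derivative (velocity \<gamma>) (at s)) (at s)"
  using curve by (simp add: C2_Jordan_param_def C1_differentiable_on_eq vector_derivative_works)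

lemma continuous_curve: "continuous_on S \<gamma>"
  using has_velocity by (meson continuous_at_imp_continuous_on has_vector_derivative_continuous)

lemma continuous_velocity: "continuous_on S (velocity \<gamma>)"
  using has_acceleration by (meson continuous_at_imp_continuous_on has_vector_derivative_continuous)

lemma continuous_acceleration: "continuous_on UNIV (\<lambda>s. vector_derivative (velocity \<gamma>) (at s))"
  using curve by (simp add: C2_Jordan_param_def C1_differentiable_on_eq)

lemma curve_periodic: "\<gamma> (s + 1) = \<gamma> s"
  using curve by (simp add: C2_Jordan_param_def)

lemma norm_unit_tangent: "norm (unit_tangent \<gamma> s) = 1"
  using velocity_nonzero by (simp add: unit_tangent_def)

lemma norm_normal: "norm (normal \<gamma> s) = 1"
  by (simp add: normal_def tangent_eq norm_unit_tangent) (simp add: orientation_def)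

lemma velocity_inner_normal: "velocity \<gamma> s \<bullet> normal \<gamma> s = 0"
proof -
  have "velocity \<gamma> s = (norm (velocity \<gamma> s) * orientation \<gamma>) *\<^sub>R tangent \<gamma> s"
    using velocity_nonzero[of s] by (simp add: tangent_eq unit_tangent_def mult_ac flip: mult.assoc[of "orientation \<gamma>"])
  then show ?thesis by (metis inner_minus_right inner_rot90 inner_scaleR_left minus_zero mult_zero_right normal_def)
qed

lemma velocity_shift: "velocity \<gamma> (s + 1) = velocity \<gamma> s"
proof -
  have "((\<gamma> \<circ> (\<lambda>s. s + 1)) has_vector_derivative 1 *\<^sub>R velocity \<gamma> (s + 1)) (at s)"
    by (intro vector_diff_chain_at has_velocity) (auto intro!: derivative_eq_intros)
  then have "(\<gamma> has_vector_derivative velocity \<gamma> (s + 1)) (at s)"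
    by (simp add: comp_def curve_periodic)
  then show ?thesis using has_velocity vector_derivative_unique_at by blast
qed

text \<open>The velocity is continuously differentiable and never zero, so dividing it by its norm
  preserves this. The existential form keeps only existence and continuity of the
  derivative.\<close>

lemma unit_tangent_has_derivative:
  "\<exists>a. continuous_on UNIV a \<and> (\<forall>s. (unit_tangent \<gamma> has_vector_derivative a s) (at s))"
proof -
  define acc where "acc s = vector_derivative (velocity \<gamma>) (at s)" for s
  define p where "p s = - ((velocity \<gamma> s \<bullet> acc s) / norm (velocity \<gamma> s)) * inverse (norm (velocity \<gamma> s) ^ 2)" for s
  have acc: "(velocity \<gamma> has_vector_derivative acc s) (at s)" for s
    unfolding acc_def by (rule has_acceleration)
  have "((\<lambda>s. inverse (norm (velocity \<gamma> s))) has_real_derivative p s) (at s)" for s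
  proof -
    have "((\<lambda>s. norm (velocity \<gamma> s)) has_derivative (\<lambda>h. (h *\<^sub>R acc s) \<bullet> sgn (velocity \<gamma> s))) (at s)"
      by (rule has_derivative_compose[OF acc[unfolded has_vector_derivative_def]
          has_derivative_norm[OF velocity_nonzero]])
    moreover have "(h *\<^sub>R acc s) \<bullet> sgn (velocity \<gamma> s) =
        h * ((velocity \<gamma> s \<bullet> acc s) / norm (velocity \<gamma> s))" for h
      by (simp add: sgn_div_norm inner_commute field_simps)
    ultimately have "((\<lambda>s. norm (velocity \<gamma> s)) has_derivative
        (\<lambda>h. h * ((velocity \<gamma> s \<bullet> acc s) / norm (velocity \<gamma> s)))) (at s)"
      by simp
    then have "((\<lambda>s. norm (velocity \<gamma> s)) has_real_derivative
        (velocity \<gamma> s \<bullet> acc s) / norm (velocity \<gamma> s)) (at s)"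
      unfolding has_field_derivative_def by (rule has_derivative_eq_rhs) (simp add: fun_eq_iff)
    from DERIV_inverse_fun[OF this] velocity_nonzero[of s] show ?thesis
      by (simp add: p_def power2_eq_square)
  qed
  then have "(unit_tangent \<gamma> has_vector_derivative
      inverse (norm (velocity \<gamma> s)) *\<^sub>R acc s + p s *\<^sub>R velocity \<gamma> s) (at s)" for s
    unfolding unit_tangent_def by (intro has_vector_derivative_scaleR acc)
  moreover have "continuous_on UNIV (\<lambda>s. inverse (norm (velocity \<gamma> s)) *\<^sub>R acc s + p s *\<^sub>R velocity \<gamma> s)"
    unfolding p_def acc_def
    by (intro continuous_intros continuous_velocity continuous_acceleration) (auto simp: velocity_nonzero)
  ultimately show ?thesis by blast
qed

lemma has_tangent_deriv: "(unit_tangent \<gamma> has_vector_derivative tangent_deriv \<gamma> s) (at s)"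
  using unit_tangent_has_derivative vector_derivative_works differentiableI_vector by blast

lemma continuous_tangent_deriv: "continuous_on UNIV (tangent_deriv \<gamma>)"
proof -
  obtain a where a: "continuous_on UNIV a" "\<And>s. (unit_tangent \<gamma> has_vector_derivative a s) (at s)"
    using unit_tangent_has_derivative by blast
  have "tangent_deriv \<gamma> s = a s" for s by (rule vector_derivative_at[OF a(2)])
  with a(1) show ?thesis by simp
qed

text \<open>Differentiating the constant squared norm of the unit tangent gives orthogonality to the
  unit tangent, hence to the velocity.\<close>

lemma velocity_inner_tangent_deriv: "velocity \<gamma> s \<bullet> tangent_deriv \<gamma> s = 0"
proof -
  have "((\<lambda>s. unit_tangent \<gamma> s \<bullet> unit_tangent \<gamma> s) has_derivative
      (\<lambda>h. unit_tangent \<gamma> s \<bullet> (h *\<^sub>R tangent_deriv \<gamma> s) + (h *\<^sub>R tangent_deriv \<gamma> s) \<bullet> unit_tangent \<gamma> s)) (at s)"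
    using has_tangent_deriv[of s] unfolding has_vector_derivative_def by (intro has_derivative_inner)
  moreover have "(\<lambda>s. unit_tangent \<gamma> s \<bullet> unit_tangent \<gamma> s) = (\<lambda>s. 1)"
    using norm_unit_tangent by (simp add: norm_eq_1)
  ultimately have "(\<lambda>h. unit_tangent \<gamma> s \<bullet> (h *\<^sub>R tangent_deriv \<gamma> s) +
      (h *\<^sub>R tangent_deriv \<gamma> s) \<bullet> unit_tangent \<gamma> s) = (\<lambda>h. 0)"
    by (simp only:) (rule has_derivative_unique[OF _ has_derivative_const])
  from fun_cong[OF this, of 1] have "unit_tangent \<gamma> s \<bullet> tangent_deriv \<gamma> s = 0"
    by (simp add: inner_commute)
  then show ?thesis
    using velocity_nonzero[of s] by (simp add: unit_tangent_def inner_commute)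
qed

lemma tangent_deriv_shift: "tangent_deriv \<gamma> (s + 1) = tangent_deriv \<gamma> s"
proof -
  have "((unit_tangent \<gamma> \<circ> (\<lambda>s. s + 1)) has_vector_derivative 1 *\<^sub>R tangent_deriv \<gamma> (s + 1)) (at s)"
    by (intro vector_diff_chain_at has_tangent_deriv) (auto intro!: derivative_eq_intros)
  moreover have "unit_tangent \<gamma> \<circ> (\<lambda>s. s + 1) = unit_tangent \<gamma>"
    by (simp add: fun_eq_iff unit_tangent_def velocity_shift)
  ultimately have "(unit_tangent \<gamma> has_vector_derivative tangent_deriv \<gamma> (s + 1)) (at s)" by simp
  then show ?thesis using has_tangent_deriv vector_derivative_unique_at by blast
qed

text \<open>Both the normal and the arclength derivative change sign with the orientation, so that
  their product does not depend on it.\<close>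

lemma curvature_normal:
  "norm (velocity \<gamma> s) *\<^sub>R curvature \<gamma> s *\<^sub>R normal \<gamma> s = - tangent_deriv \<gamma> s"
proof -
  let ?n = "normal \<gamma> s" and ?a = "- arclength_deriv \<gamma> (tangent \<gamma>) s"
  have "(tangent \<gamma> has_vector_derivative orientation \<gamma> *\<^sub>R tangent_deriv \<gamma> s) (at s)"
    unfolding tangent_eq
    by (rule bounded_linear.has_vector_derivative[OF bounded_linear_scaleR_right has_tangent_deriv])
  then have "arclength_deriv \<gamma> (tangent \<gamma>) s = (1 / norm (velocity \<gamma> s)) *\<^sub>R tangent_deriv \<gamma> s"
    by (simp add: arclength_deriv_def vector_derivative_at)
  then have a: "norm (velocity \<gamma> s) *\<^sub>R ?a = - tangent_deriv \<gamma> s" "velocity \<gamma> s \<bullet> ?a = 0"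
    using velocity_nonzero velocity_inner_tangent_deriv by simp_all
  have n: "norm ?n = 1" by (rule norm_normal)
  have "(?n \<bullet> ?a) *\<^sub>R ?n = ?a"
    by (rule orthogonal_expansion_R2[OF n velocity_nonzero velocity_inner_normal a(2)])
  moreover have "k = ?n \<bullet> ?a" if "k *\<^sub>R ?n = ?a" for k
    using n by (simp flip: that add: norm_eq_1)
  ultimately have "curvature \<gamma> s *\<^sub>R ?n = ?a"
    unfolding curvature_def by (rule theI)
  then show ?thesis using a(1) by simp
qed

text \<open>The speed from the arclength element combines with curvature and normal into the
  derivative of the unit tangent. This removes both the orientation and the definite description
  from the integrals.\<close>

lemma weighted_integrand:
  "norm (velocity \<gamma> s) *\<^sub>R integrand \<gamma> x s = - (E (x - \<gamma> s) *v tangent_deriv \<gamma> s)"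
proof -
  have "norm (velocity \<gamma> s) *\<^sub>R integrand \<gamma> x s =
      E (x - \<gamma> s) *v (norm (velocity \<gamma> s) *\<^sub>R curvature \<gamma> s *\<^sub>R normal \<gamma> s)"
    by (simp add: integrand_def matrix_vector_mult_scaleR)
  also have "\<dots> = E (x - \<gamma> s) *v (- tangent_deriv \<gamma> s)" by (simp only: curvature_normal)
  finally show ?thesis by (simp add: E_mult)
qed

lemma arc_integrable_off_curve:
  assumes "x \<notin> path_image \<gamma>"
  shows "arc_integrable \<gamma> (integrand \<gamma> x)"
proof -
  have "x - \<gamma> s \<noteq> 0" if "s \<in> {0..1}" for s using assms that by (auto simp: path_image_def)
  then have "continuous_on {0..1} (\<lambda>s. - (E (x - \<gamma> s) *v tangent_deriv \<gamma> s))"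
    unfolding E_mult
    by (intro continuous_intros continuous_curve continuous_on_subset[OF continuous_tangent_deriv]) auto
  then show ?thesis
    unfolding arc_integrable_def weighted_integrand by (rule borel_integrable_atLeastAtMost')
qed

text \<open>Reduced modulo 1, both parameters must agree because the path is simple; so
  \<open>s\<close> is an integer, and |s| \<le> 1/2 leaves only 0.\<close>

lemma curve_injective:
  assumes "\<gamma> (t + s) = \<gamma> t" "\<bar>s\<bar> \<le> 1/2"
  shows "s = 0"
proof -
  interpret periodic_fun_simple' \<gamma> by standard (rule curve_periodic)
  have frac: "\<gamma> (frac x) = \<gamma> x" for x by (simp add: frac_def minus_of_int)
  have "frac (t + s) = frac t"
  proof -
    have "\<gamma> (frac (t + s)) = \<gamma> (frac t)" by (simp add: frac assms)
    moreover have "frac (t + s) \<in> {0..1}" "frac t \<in> {0..1}" by (auto simp: frac_lt_1 less_imp_le)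
    \<comment> \<open>This excludes the coincidence of the endpoints 0 and 1, which
      \<open>loop_free\<close> permits.\<close>
    moreover have "frac (t + s) < 1" "frac t < 1" by (simp_all add: frac_lt_1)
    moreover have "loop_free \<gamma>" using curve by (simp add: C2_Jordan_param_def simple_path_def)
    ultimately show ?thesis unfolding loop_free_def by (metis less_irrefl)
  qed
  then have "s = of_int (\<lfloor>t + s\<rfloor> - \<lfloor>t\<rfloor>)" by (simp add: frac_def)
  then obtain k :: int where "s = of_int k" by blast
  with assms(2) show ?thesis by (cases "k = 0") auto
qed

text \<open>With \<open>g\<close> the tangent derivative at \<open>q = t + s\<close>, the function
  \<open>\<gamma> x \<bullet> g\<close> has derivative
  \<open>velocity \<gamma> x \<bullet> g\<close>, which vanishes at \<open>x = q\<close> and so is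
  O(|s|) between \<open>t\<close> and \<open>q\<close>. A second mean value estimate yields the
  square.\<close>

lemma tangent_deriv_inner_chord:
  obtains C where "\<And>s. \<bar>s\<bar> \<le> 1/2 \<Longrightarrow> \<bar>(\<gamma> t - \<gamma> (t + s)) \<bullet> tangent_deriv \<gamma> (t + s)\<bar> \<le> C * s\<^sup>2"
proof -
  let ?I = "{t - 1/2..t + 1/2}"
  have "bounded ((\<lambda>s. vector_derivative (velocity \<gamma>) (at s)) ` ?I)" "bounded (tangent_deriv \<gamma> ` ?I)"
    by (intro compact_imp_bounded compact_continuous_image continuous_on_subset[OF continuous_acceleration]
        continuous_on_subset[OF continuous_tangent_deriv]; simp)+
  then obtain M G where "\<forall>s\<in>?I. norm (vector_derivative (velocity \<gamma>) (at s)) \<le> M"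
    "\<forall>s\<in>?I. norm (tangent_deriv \<gamma> s) \<le> G"
    unfolding bounded_iff ball_simps by blast
  then have M: "\<And>s. s \<in> ?I \<Longrightarrow> norm (vector_derivative (velocity \<gamma>) (at s)) \<le> M"
    and G: "\<And>s. s \<in> ?I \<Longrightarrow> norm (tangent_deriv \<gamma> s) \<le> G" by blast+
  have M0: "M \<ge> 0" by (rule order_trans[OF norm_ge_zero M[of t]]) simp
  have lip: "norm (velocity \<gamma> p - velocity \<gamma> q) \<le> M * norm (p - q)" if "p \<in> ?I" "q \<in> ?I" for p q
  proof (rule differentiable_bound[where S = ?I and f' = "\<lambda>x h. h *\<^sub>R vector_derivative (velocity \<gamma>) (at x)"])
    show "(velocity \<gamma> has_derivative (\<lambda>h. h *\<^sub>R vector_derivative (velocity \<gamma>) (at x))) (at x within ?I)" for x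
      using has_acceleration[of x] unfolding has_vector_derivative_def by (rule has_derivative_at_withinI)
    show "onorm (\<lambda>h. h *\<^sub>R vector_derivative (velocity \<gamma>) (at x)) \<le> M" if "x \<in> ?I" for x
      by (rule onorm_bound[OF M0]) (simp add: mult.commute[of M] mult_left_mono M[OF that])
  qed (use that in auto)
  have "\<bar>(\<gamma> t - \<gamma> (t + s)) \<bullet> tangent_deriv \<gamma> (t + s)\<bar> \<le> M * G * s\<^sup>2" if s: "\<bar>s\<bar> \<le> 1/2" for s
  proof -
    define q where "q = t + s"
    define g where "g = tangent_deriv \<gamma> q"
    \<comment> \<open>Minimum and maximum cover both signs of \<open>s\<close>.\<close>
    define J where "J = {min t q..max t q}"
    have J: "J \<subseteq> ?I" "t \<in> J" "q \<in> J" using s by (auto simp: J_def q_def abs_le_iff)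
    have qg: "velocity \<gamma> q \<bullet> g = 0" unfolding g_def by (rule velocity_inner_tangent_deriv)
    have g: "norm g \<le> G" unfolding g_def using J by (intro G) auto
    have "norm (\<gamma> t \<bullet> g - \<gamma> q \<bullet> g) \<le> M * \<bar>s\<bar> * G * norm (t - q)"
    proof (rule differentiable_bound[where S = J and f' = "\<lambda>x h. h *\<^sub>R (velocity \<gamma> x \<bullet> g)"])
      show "((\<lambda>x. \<gamma> x \<bullet> g) has_derivative (\<lambda>h. h *\<^sub>R (velocity \<gamma> x \<bullet> g))) (at x within J)" for x
        by (rule has_derivative_at_withinI)
           (use has_velocity[of x, unfolded has_vector_derivative_def] in
             \<open>auto intro!: derivative_eq_intros\<close>)
      show "onorm (\<lambda>h. h *\<^sub>R (velocity \<gamma> x \<bullet> g)) \<le> M * \<bar>s\<bar> * G" if x: "x \<in> J" for x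
      proof -
        have "\<bar>velocity \<gamma> x \<bullet> g\<bar> = \<bar>(velocity \<gamma> x - velocity \<gamma> q) \<bullet> g\<bar>" by (simp add: inner_diff_left qg)
        also have "\<dots> \<le> norm (velocity \<gamma> x - velocity \<gamma> q) * norm g" by (rule Cauchy_Schwarz_ineq2)
        also have "\<dots> \<le> (M * norm (x - q)) * G" using J x by (intro mult_mono lip g) (auto simp: M0)
        also have "\<dots> \<le> (M * \<bar>s\<bar>) * G"
          using x M0 order_trans[OF norm_ge_zero g]
          by (intro mult_right_mono mult_left_mono) (auto simp: J_def q_def)
        finally have *: "\<bar>velocity \<gamma> x \<bullet> g\<bar> \<le> M * \<bar>s\<bar> * G" .
        show ?thesis
        proof (rule onorm_bound)
          show "norm (h *\<^sub>R (velocity \<gamma> x \<bullet> g)) \<le> M * \<bar>s\<bar> * G * norm h" for h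
            using mult_right_mono[OF *, of "\<bar>h\<bar>"] by (simp add: abs_mult mult.commute[of "\<bar>h\<bar>"])
        qed (rule order_trans[OF abs_ge_zero *])
      qed
    qed (use J in \<open>auto simp: J_def\<close>)
    then show ?thesis
      by (simp add: inner_diff_left q_def g_def power2_eq_square mult_ac)
  qed
  then show ?thesis using that by blast
qed

text \<open>The chord vanishes only at \<open>s = 0\<close> within half a period, which gives the
  lower bounds; \<open>G\<close> comes from compactness and \<open>C\<close> from the chord
  estimate.\<close>

lemma offset_integral_curve:
  obtains c r G C where "offset_integral (\<lambda>s. \<gamma> t - \<gamma> (t + s)) (\<lambda>s. tangent_deriv \<gamma> (t + s))
    (normal \<gamma> t) (velocity \<gamma> t) c r G C"
proof -
  define d where "d s = \<gamma> t - \<gamma> (t + s)" for s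
  have "((\<gamma> \<circ> (\<lambda>s. t + s)) has_vector_derivative 1 *\<^sub>R velocity \<gamma> (t + 0)) (at 0)"
    by (intro vector_diff_chain_at has_velocity) (auto intro!: derivative_eq_intros)
  then have "(d has_vector_derivative 0 - velocity \<gamma> t) (at 0)"
    unfolding d_def by (intro has_vector_derivative_diff has_vector_derivative_const) (simp add: comp_def)
  then have deriv: "(d has_vector_derivative - velocity \<gamma> t) (at 0)" by simp
  have d0: "d 0 = 0" by (simp add: d_def)
  have cont_d: "continuous_on UNIV d"
    unfolding d_def by (intro continuous_intros continuous_on_compose2[OF continuous_curve[of UNIV]]) auto
  have cont_g: "continuous_on UNIV (\<lambda>s. tangent_deriv \<gamma> (t + s))"
    by (rule continuous_on_compose2[OF continuous_tangent_deriv]) (auto intro!: continuous_intros)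
  have inj: "d s \<noteq> 0" if "s \<noteq> 0" "\<bar>s\<bar> \<le> 1/2" for s
    using curve_injective[of t s] that by (auto simp: d_def)
  obtain c r where "c > 0" "r > 0"
    "\<And>s l. \<bar>s\<bar> \<le> 1/2 \<Longrightarrow> \<bar>l\<bar> < r \<Longrightarrow> c * \<bar>s\<bar> \<le> norm (l *\<^sub>R normal \<gamma> t + d s)"
    "\<And>s l. \<bar>s\<bar> \<le> 1/2 \<Longrightarrow> \<bar>l\<bar> < r \<Longrightarrow> c * \<bar>l\<bar> \<le> norm (l *\<^sub>R normal \<gamma> t + d s)"
    by (rule norm_normal_offset_ge[OF deriv d0 cont_d _ velocity_nonzero norm_normal velocity_inner_normal],
        erule (1) inj, rule that)
  moreover obtain C where "\<And>s. \<bar>s\<bar> \<le> 1/2 \<Longrightarrow> \<bar>d s \<bullet> tangent_deriv \<gamma> (t + s)\<bar> \<le> C * s\<^sup>2"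
    using tangent_deriv_inner_chord[of t] unfolding d_def by blast
  moreover have "bounded ((\<lambda>s. tangent_deriv \<gamma> (t + s)) ` {-1/2..1/2})"
    by (intro compact_imp_bounded compact_continuous_image continuous_on_subset[OF cont_g]) auto
  then obtain G where "\<forall>s\<in>{-1/2..1/2}. norm (tangent_deriv \<gamma> (t + s)) \<le> G"
    unfolding bounded_iff ball_simps by blast
  then have "norm (tangent_deriv \<gamma> (t + s)) \<le> G" if "\<bar>s\<bar> \<le> 1/2" for s
    by (rule bspec) (use that in \<open>unfold atLeastAtMost_iff, linarith\<close>)
  ultimately have "offset_integral d (\<lambda>s. tangent_deriv \<gamma> (t + s)) (normal \<gamma> t) (velocity \<gamma> t) c r G C"
    by unfold_locales (simp_all add: deriv d0 cont_d cont_g velocity_nonzero norm_normal velocity_inner_normal)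
  then show ?thesis using that unfolding d_def by blast
qed


text \<open>Centres the period at \<open>t\<close>. A bound over one period extends to all
  parameters, so integrability follows even when \<open>x\<close> lies on the curve.\<close>

lemma arc_integral_shift:
  assumes bound: "\<And>s. \<bar>s\<bar> \<le> 1/2 \<Longrightarrow> norm (E (x - \<gamma> (t + s)) *v tangent_deriv \<gamma> (t + s)) \<le> B"
  shows "arc_integrable \<gamma> (integrand \<gamma> x)"
    and "arc_integral \<gamma> (integrand \<gamma> x) =
      - (LINT s:{-1/2..1/2}|lborel. E (x - \<gamma> (t + s)) *v tangent_deriv \<gamma> (t + s))"
proof -
  define f where "f s = E (x - \<gamma> s) *v tangent_deriv \<gamma> s" for s
  have per: "f (s + 1) = f s" for s by (simp add: f_def curve_periodic tangent_deriv_shift)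
  interpret periodic_fun_simple' f by standard (rule per)
  have [measurable]: "\<gamma> \<in> borel_measurable borel" "tangent_deriv \<gamma> \<in> borel_measurable borel"
    by (intro borel_measurable_continuous_onI continuous_curve continuous_tangent_deriv)+
  have meas [measurable]: "f \<in> borel_measurable borel"
    unfolding f_def E_mult by measurable
  have f_le: "norm (f s) \<le> B" for s
  proof -
    \<comment> \<open>Removing the nearest integer brings \<open>s - t\<close> within 1/2 of
      0.\<close>
    have "f s = f (t + ((s - t) - of_int (round (s - t))))"
      using minus_of_int[of s "round (s - t)"] by simp
    moreover have "\<bar>(s - t) - of_int (round (s - t))\<bar> \<le> 1/2"
      by (metis abs_minus_commute of_int_round_abs_le)
    ultimately show ?thesis using bound unfolding f_def by metis
  qed
  have integ: "set_integrable lborel {0..1} f"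
    unfolding set_integrable_def
    by (rule integrableI_bounded_set_indicator[where B = B]) (auto simp: f_le)
  then show "arc_integrable \<gamma> (integrand \<gamma> x)"
    unfolding arc_integrable_def weighted_integrand f_def set_integrable_def by simp
  have "arc_integral \<gamma> (integrand \<gamma> x) = - (LINT s:{0..1}|lborel. f s)"
    unfolding arc_integral_def weighted_integrand f_def set_lebesgue_integral_def by simp
  also have "(LINT s:{0..1}|lborel. f s) = (LINT s:{t - 1/2..t - 1/2 + 1}|lborel. f s)"
    by (rule periodic_integral_shift[OF per meas f_le, symmetric])
  also have "\<dots> = (LINT s:{-1/2..1/2}|lborel. f (t + s))"
    unfolding set_lebesgue_integral_def
    by (subst lborel_integral_real_affine[where c = 1 and t = t])
       (auto simp: indicator_def intro!: Bochner_Integration.integral_cong)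
  finally show "arc_integral \<gamma> (integrand \<gamma> x) =
      - (LINT s:{-1/2..1/2}|lborel. E (x - \<gamma> (t + s)) *v tangent_deriv \<gamma> (t + s))"
    by (simp add: f_def)
qed

end

section \<open>The limit of the potential along the normal\<close>

theorem proposition3p4:
  fixes \<gamma> :: "real \<Rightarrow> real^2" and t :: real and z :: "real^2"
  assumes "C2_Jordan_param \<gamma>" and "z = \<gamma> t"
  shows "(\<forall>x. x \<notin> path_image \<gamma> \<longrightarrow> arc_integrable \<gamma> (integrand \<gamma> x)) \<and>
    arc_integrable \<gamma> (integrand \<gamma> z) \<and>
    ((\<lambda>l. u \<gamma> (z + l *\<^sub>R normal \<gamma> t)) \<longlongrightarrow>
       - ((1 / pi) *\<^sub>R curvature \<gamma> t *\<^sub>R normal \<gamma> t) - arc_integral \<gamma> (integrand \<gamma> z)) (at 0)"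
proof (intro conjI allI impI)
  show "arc_integrable \<gamma> (integrand \<gamma> x)" if "x \<notin> path_image \<gamma>" for x
    using arc_integrable_off_curve[OF assms(1) that] .
  let ?n = "normal \<gamma> t" and ?g = "tangent_deriv \<gamma> t" and ?w = "velocity \<gamma> t"
  obtain c r G C where "offset_integral (\<lambda>s. \<gamma> t - \<gamma> (t + s)) (\<lambda>s. tangent_deriv \<gamma> (t + s)) ?n ?w c r G C"
    by (rule offset_integral_curve[OF assms(1)])
  then interpret L: offset_integral "\<lambda>s. \<gamma> t - \<gamma> (t + s)" "\<lambda>s. tangent_deriv \<gamma> (t + s)" ?n ?w c r G C .
  have kernel: "E (z + l *\<^sub>R ?n - \<gamma> (t + s)) *v tangent_deriv \<gamma> (t + s) =
      (1 / (2 * pi)) *\<^sub>R (L.singular l s + L.regular l s)" for l s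
  proof -
    have "z + l *\<^sub>R ?n - \<gamma> (t + s) = l *\<^sub>R ?n + (\<gamma> t - \<gamma> (t + s))" by (simp add: assms(2))
    then show ?thesis by (simp only: E_mult L.singular_plus_regular) simp
  qed
  \<comment> \<open>The value \<open>l = 0\<close> is included and yields the integral at
    \<open>z\<close> itself.\<close>
  have near: "arc_integrable \<gamma> (integrand \<gamma> (z + l *\<^sub>R ?n))"
    "arc_integral \<gamma> (integrand \<gamma> (z + l *\<^sub>R ?n)) =
      - ((1 / (2 * pi)) *\<^sub>R (LINT s:{-1/2..1/2}|lborel. L.singular l s + L.regular l s))"
    if l: "\<bar>l\<bar> < r" for l
  proof -
    obtain B where B: "\<And>s. \<bar>s\<bar> \<le> 1/2 \<Longrightarrow> norm (L.singular l s + L.regular l s) \<le> B"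
      using L.kernel_bounded[OF l] by blast
    have "norm (E (z + l *\<^sub>R ?n - \<gamma> (t + s)) *v tangent_deriv \<gamma> (t + s)) \<le> 1 / (2 * pi) * B"
      if "\<bar>s\<bar> \<le> 1/2" for s
      unfolding kernel norm_scaleR using mult_left_mono[OF B[OF that], of "1 / (2 * pi)"] by simp
    note shift = arc_integral_shift[where t = t and x = "z + l *\<^sub>R ?n", OF assms(1) this]
    show "arc_integrable \<gamma> (integrand \<gamma> (z + l *\<^sub>R ?n))" by (rule shift(1))
    show "arc_integral \<gamma> (integrand \<gamma> (z + l *\<^sub>R ?n)) =
      - ((1 / (2 * pi)) *\<^sub>R (LINT s:{-1/2..1/2}|lborel. L.singular l s + L.regular l s))"
      by (simp only: shift(2) kernel set_integral_scaleR_right)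
  qed
  show "arc_integrable \<gamma> (integrand \<gamma> z)" using near(1)[of 0] L.cr by simp
  have "(?n \<bullet> ?g) *\<^sub>R ?n = ?g"
    by (rule orthogonal_expansion_R2[OF L.n(1) L.w L.n(2) velocity_inner_tangent_deriv[OF assms(1)]])
  also have "\<dots> = - (norm ?w *\<^sub>R curvature \<gamma> t *\<^sub>R ?n)" using curvature_normal[OF assms(1), of t] by simp
  finally have "(1 / (pi * norm ?w)) *\<^sub>R ((?n \<bullet> ?g) *\<^sub>R ?n) =
      (1 / (pi * norm ?w)) *\<^sub>R (- (norm ?w *\<^sub>R curvature \<gamma> t *\<^sub>R ?n))" by simp
  \<comment> \<open>The tangent derivative is purely normal and equals
    \<open>- (norm ?w *\<^sub>R curvature \<gamma> t *\<^sub>R ?n)\<close>; so the speed cancels,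
    and the 2 of the profile integral turns \<open>1 / (2 * pi)\<close> into
    \<open>1 / pi\<close>.\<close>
  then have jump: "(1 / (2 * pi)) *\<^sub>R ((2 * (?n \<bullet> ?g) / norm ?w) *\<^sub>R ?n) =
      - ((1 / pi) *\<^sub>R curvature \<gamma> t *\<^sub>R ?n)"
    using L.w by (simp add: mult.commute)
  have "((\<lambda>l. (1 / (2 * pi)) *\<^sub>R (LINT s:{-1/2..1/2}|lborel. L.singular l s + L.regular l s)) \<longlongrightarrow>
      (1 / (2 * pi)) *\<^sub>R ((2 * (?n \<bullet> ?g) / norm ?w) *\<^sub>R ?n +
        (LINT s:{-1/2..1/2}|lborel. L.singular 0 s + L.regular 0 s))) (at 0)"
    using L.offset_integral_tendsto by (intro tendsto_scaleR tendsto_const) simp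
  also have "(1 / (2 * pi)) *\<^sub>R ((2 * (?n \<bullet> ?g) / norm ?w) *\<^sub>R ?n +
        (LINT s:{-1/2..1/2}|lborel. L.singular 0 s + L.regular 0 s)) =
      - ((1 / pi) *\<^sub>R curvature \<gamma> t *\<^sub>R ?n) - arc_integral \<gamma> (integrand \<gamma> z)"
    using near(2)[of 0] L.cr unfolding scaleR_add_right jump by simp
  finally show "((\<lambda>l. u \<gamma> (z + l *\<^sub>R ?n)) \<longlongrightarrow>
      - ((1 / pi) *\<^sub>R curvature \<gamma> t *\<^sub>R ?n) - arc_integral \<gamma> (integrand \<gamma> z)) (at 0)"
  proof (rule Lim_transform_eventually)
    have "\<forall>\<^sub>F l in at 0. \<bar>l\<bar> < r"
      using L.cr(2) by (auto simp: eventually_at intro!: exI[of _ r])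
    then show "\<forall>\<^sub>F l in at 0.
        (1 / (2 * pi)) *\<^sub>R (LINT s:{-1/2..1/2}|lborel. L.singular l s + L.regular l s) =
        u \<gamma> (z + l *\<^sub>R ?n)"
      by eventually_elim (simp only: u_def near(2) minus_minus)
  qed
qed

end
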